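(* Let $s\ge 1$ and let $G$ be a graph on $n$ vertices. Then the following are equivalent: (a) for every choice of nonsingular $s\times s$ weight matrices on the edges of $G$, the associated weighted Laplacian matrix $L$ has rank $(n-1)s$; (b) $G$ is a tree.
   Context: Graphs are finite, simple and undirected, with vertex set $\{1,\dots,n\}$. Matrices have real entries. If each edge $e$ of $G$ is assigned a nonsingular $s\times s$ matrix $W_e$ (its weight), the associated weighted Laplacian matrix $L$ is the $ns\times ns$ block matrix with $s\times s$ blocks indexed by pairs of vertices: the $(i,i)$ block is the sum of $W_e^{-1}$ over all edges $e$ incident with $i$; for $i\ne j$ the $(i,j)$ block is $-W_e^{-1}$ if $e=\{i,j\}$ is an edge, and the zero matrix otherwise. (The Laplacian uses the inverses of the edge weights.) *)

theory Defs
  imports "HOL-Analysis.Analysis"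
begin

text \<open>
  A graph on \<open>n\<close> vertices has as its vertex set all of a finite type \<open>'n\<close> (so \<open>n = CARD('n)\<close> and
  \<open>n \<ge> 1\<close>) and is given by its set of edges, each edge being an unordered pair of distinct vertices.
\<close>

definition simple_graph :: "'n::finite set set \<Rightarrow> bool" where
  "simple_graph E \<longleftrightarrow> (\<forall>e\<in>E. card e = 2)"

definition graph_connected :: "'n::finite set set \<Rightarrow> bool" where
  "graph_connected E \<longleftrightarrow> (\<forall>u v. (u, v) \<in> {(x, y). {x, y} \<in> E}\<^sup>*)"

text \<open>
  A cycle is listed by its vertices \<open>c\<^sub>0, \<dots>, c\<^sub>k\<^sub>-\<^sub>1\<close> without repeating the first one at the end;
  the index \<open>Suc i mod k\<close> closes it up.
\<close>

definition graph_cycle :: "'n::finite set set \<Rightarrow> 'n list \<Rightarrow> bool" where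
  "graph_cycle E c \<longleftrightarrow> length c \<ge> 3 \<and> distinct c \<and>
     (\<forall>i<length c. {c ! i, c ! (Suc i mod length c)} \<in> E)"

definition is_tree :: "'n::finite set set \<Rightarrow> bool" where
  "is_tree E \<longleftrightarrow> graph_connected E \<and> \<not> (\<exists>c. graph_cycle E c)"

definition laplacian_block ::
  "'n::finite set set \<Rightarrow> ('n set \<Rightarrow> real^'s::finite^'s) \<Rightarrow> 'n \<Rightarrow> 'n \<Rightarrow> real^'s^'s" where
  "laplacian_block E W i j =
     (if i = j then (\<Sum>e\<in>{e\<in>E. i \<in> e}. matrix_inv (W e))
      else if {i, j} \<in> E then - matrix_inv (W {i, j})
      else 0)"

text \<open>
  The \<open>ns \<times> ns\<close> matrix assembled from these blocks: rows and columns are indexed by pairs of a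
  vertex (selecting the block) and a position inside the block.
\<close>

definition weighted_laplacian ::
  "'n::finite set set \<Rightarrow> ('n set \<Rightarrow> real^'s::finite^'s) \<Rightarrow> real^('n \<times> 's)^('n \<times> 's)" where
  "weighted_laplacian E W =
     (\<chi> p q. laplacian_block E W (fst p) (fst q) $ snd p $ snd q)"

end

theory Submission
  imports Defs
begin

text \<open>
  Read a vector as a map \<open>x\<close> from the vertices to \<open>\<real>\<^sup>s\<close>. Constant maps lie in the kernel of \<open>L\<close>, so by
  rank-nullity the rank is \<open>(n - 1) s\<close> exactly when the kernel contains nothing else. For \<open>x\<close> in the
  kernel, the values \<open>W\<^sub>e\<^sup>-\<^sup>1 (x\<^sub>i - x\<^sub>j)\<close> form a conserved flow along the edges. A nonzero conserved flow
  can be followed forever without backtracking and so traces a cycle; hence on a tree the flow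
  vanishes and \<open>x\<close> is constant.

  Conversely, a disconnected graph has the indicator of a component in its kernel for \<open>W = 1\<close>. In a
  connected graph with a cycle, remove an edge \<open>ab\<close> of the cycle and solve the scalar equation
  \<open>L' x = \<delta>\<^sub>a - \<delta>\<^sub>b\<close> on the rest, which is still connected; then \<open>x\<^sub>a \<noteq> x\<^sub>b\<close>, and \<open>x\<close> is in the
  kernel once \<open>ab\<close> is given the weight \<open>-(x\<^sub>a - x\<^sub>b)\<close>.
\<close>

section \<open>Matrix inverses and rank-nullity\<close>

lemma matrix_inv_left_right:
  assumes "invertible A"
  shows "A ** matrix_inv A = mat 1" "matrix_inv A ** A = mat 1"
proof -
  have "A ** matrix_inv A = mat 1 \<and> matrix_inv A ** A = mat 1"
    unfolding matrix_inv_def using assms unfolding invertible_def by (rule someI_ex)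
  then show "A ** matrix_inv A = mat 1" "matrix_inv A ** A = mat 1" by auto
qed

lemma matrix_inv_mult_eq_0_iff:
  fixes A :: "real^'s^'s"
  assumes "invertible A"
  shows "matrix_inv A *v x = 0 \<longleftrightarrow> x = 0"
proof
  assume "matrix_inv A *v x = 0"
  then have "A *v (matrix_inv A *v x) = 0" by simp
  then show "x = 0"
    by (simp add: matrix_vector_mul_assoc matrix_inv_left_right[OF assms] del: matrix_vector_mult_0_right)
qed simp

lemma matrix_inv_mat:
  fixes c :: real
  assumes "c \<noteq> 0"
  shows "invertible (mat c :: real^'s^'s)" "matrix_inv (mat c :: real^'s^'s) *v x = (1 / c) *\<^sub>R x"
proof -
  have mv: "(mat d :: real^'s^'s) *v y = d *\<^sub>R y" for d :: real and y
    by (simp add: vec_eq_iff matrix_vector_mult_def mat_def if_distrib[of "\<lambda>z. z * _"] cong: if_cong)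
  have "mat c ** mat (1 / c) = (mat 1 :: real^'s^'s)" "mat (1 / c) ** mat c = (mat 1 :: real^'s^'s)"
    using assms by (simp_all add: matrix_eq matrix_vector_mul_assoc[symmetric] mv)
  then show inv: "invertible (mat c :: real^'s^'s)"
    unfolding invertible_def by blast
  have "c *\<^sub>R (matrix_inv (mat c :: real^'s^'s) *v x) = x"
    by (simp add: mv[symmetric] matrix_vector_mul_assoc matrix_inv_left_right[OF inv])
  then have "(1 / c) *\<^sub>R x = (1 / c) *\<^sub>R (c *\<^sub>R (matrix_inv (mat c :: real^'s^'s) *v x))"
    by simp
  then show "matrix_inv (mat c :: real^'s^'s) *v x = (1 / c) *\<^sub>R x"
    using assms by simp
qed

text \<open>The null space is the orthogonal complement of the row space, whose dimension is the
  rank.\<close>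

lemma rank_plus_dim_nullspace:
  fixes A :: "real^'n^'m"
  shows "rank A + dim {x. A *v x = 0} = CARD('n)"
proof -
  have "{y \<in> UNIV. \<forall>x\<in>span (rows A). orthogonal x y} = {x. A *v x = 0}"
  proof (intro set_eqI iffI; clarsimp)
    fix y assume y: "\<forall>x\<in>span (rows A). orthogonal x y"
    show "A *v y = 0"
    proof (simp add: vec_eq_iff, rule allI)
      fix i
      have "row i A \<in> span (rows A)" by (rule span_base) (auto simp: rows_def)
      then have "orthogonal (row i A) y" using y by blast
      then show "(A *v y) $ i = 0"
        by (simp add: orthogonal_def matrix_vector_mul_component row_def)
    qed
  next
    fix x y assume "A *v y = 0" "x \<in> span (rows A)"
    then show "orthogonal x y"
      using orthogonal_nullspace_rowspace orthogonal_commute by blast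
  qed
  then show ?thesis
    using dim_subspace_orthogonal_to_vectors[of "span (rows A)" UNIV]
    by (simp add: row_rank_def)
qed

section \<open>The kernel of the weighted Laplacian\<close>

lemma simple_graphD:
  assumes "simple_graph E" "{i, j} \<in> E"
  shows "i \<noteq> j"
  using assms by (auto simp: simple_graph_def)

lemma sum_incident_edges:
  fixes E :: "'n::finite set set"
  assumes "simple_graph E"
  shows "(\<Sum>e\<in>{e\<in>E. i \<in> e}. f e) = (\<Sum>j\<in>{j. {i, j} \<in> E}. f {i, j})"
proof (rule sum.reindex_cong[of "\<lambda>j. {i, j}"])
  show "inj_on (\<lambda>j. {i, j}) {j. {i, j} \<in> E}"
    by (auto simp: inj_on_def doubleton_eq_iff)
  show "{e \<in> E. i \<in> e} = (\<lambda>j. {i, j}) ` {j. {i, j} \<in> E}"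
  proof (intro equalityI subsetI)
    fix e assume e: "e \<in> {e \<in> E. i \<in> e}"
    then have "card e = 2" using assms by (auto simp: simple_graph_def)
    then obtain x y where "e = {x, y}" by (auto simp: card_2_iff)
    then have "e = {i, if x = i then y else x}" using e by auto
    then show "e \<in> (\<lambda>j. {i, j}) ` {j. {i, j} \<in> E}" using e by blast
  qed auto
qed simp

text \<open>The diagonal block at \<open>i\<close> sums the same inverse weights that occur,
  negated, off the diagonal in block row \<open>i\<close>, so only differences of \<open>x\<close>
  across edges survive.\<close>

lemma weighted_laplacian_mult:
  fixes W :: "'n::finite set \<Rightarrow> real^'s::finite^'s" and x :: "'n \<Rightarrow> real^'s"
  assumes E: "simple_graph E"
  shows "(weighted_laplacian E W *v (\<chi> p. x (fst p) $ snd p)) $ (i, k) =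
    (\<Sum>j\<in>{j. {i, j} \<in> E}. matrix_inv (W {i, j}) *v (x i - x j)) $ k"
proof -
  let ?N = "{j. {i, j} \<in> E}"
  have "(weighted_laplacian E W *v (\<chi> p. x (fst p) $ snd p)) $ (i, k) =
      (\<Sum>j\<in>UNIV. \<Sum>l\<in>UNIV. laplacian_block E W i j $ k $ l * x j $ l)"
    by (simp add: weighted_laplacian_def matrix_vector_mult_def sum.cartesian_product
        UNIV_Times_UNIV[symmetric] case_prod_beta del: UNIV_Times_UNIV)
  also have "\<dots> = (\<Sum>j\<in>UNIV. (laplacian_block E W i j *v x j) $ k)"
    by (simp add: matrix_vector_mult_def)
  also have "\<dots> = (laplacian_block E W i i *v x i) $ k
      + (\<Sum>j\<in>UNIV - {i}. (laplacian_block E W i j *v x j) $ k)"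
    by (rule sum.remove) auto
  also have "(\<Sum>j\<in>UNIV - {i}. (laplacian_block E W i j *v x j) $ k) =
      (\<Sum>j\<in>?N. - (matrix_inv (W {i, j}) *v x j) $ k)"
    using simple_graphD[OF E]
    by (intro sum.mono_neutral_cong_right)
       (auto simp: laplacian_block_def matrix_vector_mult_def sum_negf)
  also have "laplacian_block E W i i = (\<Sum>j\<in>?N. matrix_inv (W {i, j}))"
    by (simp add: laplacian_block_def sum_incident_edges[OF E])
  also have "(\<Sum>j\<in>?N. matrix_inv (W {i, j})) *v x i = (\<Sum>j\<in>?N. matrix_inv (W {i, j}) *v x i)"
    by (simp add: linear_sum[of "\<lambda>A. A *v x i"] linear_iff matrix_vector_mult_add_rdistrib
        scaleR_matrix_vector_assoc)
  finally show ?thesis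
    by (simp add: matrix_vector_mult_diff_distrib sum_subtractf sum_negf)
qed

lemma rank_weighted_laplacian_iff:
  fixes W :: "'n::finite set \<Rightarrow> real^'s::finite^'s"
  assumes E: "simple_graph E"
  shows "rank (weighted_laplacian E W) = (CARD('n) - 1) * CARD('s) \<longleftrightarrow>
    (\<forall>x :: 'n \<Rightarrow> real^'s. (\<forall>i. (\<Sum>j\<in>{j. {i, j} \<in> E}. matrix_inv (W {i, j}) *v (x i - x j)) = 0) \<longrightarrow>
      (\<forall>i j. x i = x j))"
proof -
  let ?L = "weighted_laplacian E W"
  let ?vec = "\<lambda>x :: 'n \<Rightarrow> real^'s. (\<chi> p. x (fst p) $ snd p) :: real^('n \<times> 's)"
  let ?S = "\<lambda>x :: 'n \<Rightarrow> real^'s. \<forall>i. (\<Sum>j\<in>{j. {i, j} \<in> E}. matrix_inv (W {i, j}) *v (x i - x j)) = 0"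
  define K where "K = {v. ?L *v v = 0}"
  define C where "C = range (\<lambda>u :: real^'s. ?vec (\<lambda>_. u))"
  have in_K: "?vec x \<in> K \<longleftrightarrow> ?S x" for x
  proof -
    have "?vec x \<in> K \<longleftrightarrow> (\<forall>i k. (?L *v ?vec x) $ (i, k) = 0)"
      by (simp add: K_def vec_eq_iff)
    also have "\<dots> \<longleftrightarrow> ?S x"
      unfolding weighted_laplacian_mult[OF E] by (simp add: vec_eq_iff)
    finally show ?thesis .
  qed
  have in_C: "?vec x \<in> C \<longleftrightarrow> (\<forall>i j. x i = x j)" for x
  proof
    assume "?vec x \<in> C"
    then show "\<forall>i j. x i = x j" by (auto simp: C_def vec_eq_iff)
  next
    assume "\<forall>i j. x i = x j"
    \<comment> \<open>Here \<open>undefined\<close> merely names some vertex at which to read off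
      the constant value.\<close>
    then have "?vec x = ?vec (\<lambda>_. x undefined)" by (simp add: vec_eq_iff)
    then show "?vec x \<in> C" unfolding C_def by (rule range_eqI)
  qed
  have K_C: "K \<subseteq> C \<longleftrightarrow> (\<forall>x. ?S x \<longrightarrow> (\<forall>i j. x i = x j))"
  proof
    assume "K \<subseteq> C"
    then show "\<forall>x. ?S x \<longrightarrow> (\<forall>i j. x i = x j)" using in_K in_C by blast
  next
    assume const: "\<forall>x. ?S x \<longrightarrow> (\<forall>i j. x i = x j)"
    show "K \<subseteq> C"
    proof
      fix v assume "v \<in> K"
      \<comment> \<open>Every vector is \<open>?vec\<close> of a map on vertices, so quantifying
        over maps covers the whole kernel.\<close>
      define x where "x i = (\<chi> k. v $ (i, k))" for i
      have v: "v = ?vec x" by (simp add: vec_eq_iff x_def)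
      have "?S x" using \<open>v \<in> K\<close> unfolding v in_K .
      then have "\<forall>i j. x i = x j" by (rule const[THEN spec, THEN mp])
      then show "v \<in> C" unfolding v in_C .
    qed
  qed
  have "C \<subseteq> K" unfolding C_def by (intro image_subsetI iffD2[OF in_K]) simp
  have "linear (\<lambda>u :: real^'s. ?vec (\<lambda>_. u))" "inj (\<lambda>u :: real^'s. ?vec (\<lambda>_. u))"
    by (auto simp: linear_iff vec_eq_iff inj_def)
  then have C: "dim C = CARD('s)" "subspace C"
    unfolding C_def by (simp_all add: dim_image_eq linear_subspace_image)
  have "subspace K"
    by (auto simp: K_def subspace_def matrix_vector_right_distrib matrix_vector_mult_scaleR)
  have dim_K: "dim K = CARD('s) \<longleftrightarrow> K \<subseteq> C"
    using subspace_dim_equal[OF \<open>subspace C\<close> \<open>subspace K\<close> \<open>C \<subseteq> K\<close>] C \<open>C \<subseteq> K\<close> by auto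
  have "rank ?L + dim K = CARD('n) * CARD('s)"
    using rank_plus_dim_nullspace[of ?L] by (simp add: K_def)
  \<comment> \<open>The subtraction is on naturals and is harmless because there is at least one
    vertex.\<close>
  moreover have "CARD('n) * CARD('s) = (CARD('n) - 1) * CARD('s) + CARD('s)"
    by (metis Suc_pred' add.commute mult_Suc zero_less_card_finite)
  ultimately have "rank ?L = (CARD('n) - 1) * CARD('s) \<longleftrightarrow> dim K = CARD('s)" by linarith
  then show ?thesis unfolding dim_K K_C .
qed

section \<open>Conserved flows on acyclic graphs\<close>

lemma no_backtrack_imp_cycle:
  fixes E :: "'n::finite set set" and w :: "nat \<Rightarrow> 'n"
  assumes E: "simple_graph E"
    and edge: "\<And>n. {w n, w (Suc n)} \<in> E"
    and nb: "\<And>n. w (Suc (Suc n)) \<noteq> w n"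
  shows "\<exists>c. graph_cycle E c"
proof -
  have "\<not> inj w" using finite_imageD[of w UNIV] by auto
  then obtain m n where "m < n" "w m = w n"
    by (metis injI linorder_neqE_nat)
  then have "n - m > 0 \<and> w m = w (m + (n - m))" by simp
  then have "\<exists>d>0. \<exists>m. w m = w (m + d)" by blast
  \<comment> \<open>Take \<open>d\<close> to be the smallest gap between equal vertices anywhere
    along the walk; then the \<open>d\<close> vertices starting at position \<open>m\<close> are
    distinct and close up.\<close>
  then obtain d where d: "d > 0" "\<exists>m. w m = w (m + d)"
    and least: "\<And>d'. d' < d \<Longrightarrow> \<not> (d' > 0 \<and> (\<exists>m. w m = w (m + d')))"
    using exists_least_iff[of "\<lambda>d. d > 0 \<and> (\<exists>m. w m = w (m + d))"] by metis
  obtain m where m: "w m = w (m + d)" using d by blast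
  \<comment> \<open>A gap of 1 would be a loop, a gap of 2 a backtrack.\<close>
  have "d \<noteq> 1" using m simple_graphD[OF E edge[of m]] by auto
  moreover have "d \<noteq> 2" using m nb[of m] by auto
  ultimately have "d \<ge> 3" using d by linarith
  let ?c = "map (\<lambda>i. w (m + i)) [0..<d]"
  have neq: "w (m + i) \<noteq> w (m + j)" if "i < j" "j < d" for i j
  proof -
    have "w (m + i) \<noteq> w (m + i + (j - i))" using least[of "j - i"] that
      by (metis less_imp_diff_less zero_less_diff)
    moreover have "m + i + (j - i) = m + j" using that by simp
    ultimately show ?thesis by metis
  qed
  have "distinct ?c"
    unfolding distinct_conv_nth using neq by (auto simp: linorder_neq_iff) (metis neq)+
  moreover have "{?c ! i, ?c ! (Suc i mod length ?c)} \<in> E" if "i < d" for i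
  proof (cases "Suc i = d")
    case True
    then have "{w (m + i), w m} \<in> E" using edge[of "m + i"] m by auto
    then show ?thesis using True that by simp
  next
    case False
    then show ?thesis using edge[of "m + i"] that by simp
  qed
  ultimately have "graph_cycle E ?c" using \<open>d \<ge> 3\<close> by (simp add: graph_cycle_def)
  then show ?thesis by blast
qed

text \<open>Flow entering a vertex must leave it along a different edge, which yields an endless
  walk without backtracking. Values in an abelian group allow flows in
  \<open>real^'s\<close>.\<close>

lemma acyclic_flow_eq_0:
  fixes E :: "'n::finite set set" and f :: "'n \<Rightarrow> 'n \<Rightarrow> 'a::ab_group_add"
  assumes E: "simple_graph E" and acyclic: "\<nexists>c. graph_cycle E c"
    and anti: "\<And>i j. f j i = - f i j"
    and conserved: "\<And>i. (\<Sum>j\<in>{j. {i, j} \<in> E}. f i j) = 0"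
    and edge: "{a, b} \<in> E"
  shows "f a b = 0"
proof (rule ccontr)
  assume nz: "f a b \<noteq> 0"
  let ?P = "\<lambda>p. {fst p, snd p} \<in> E \<and> f (fst p) (snd p) \<noteq> 0"
  \<comment> \<open>Otherwise the conserved sum at \<open>j\<close> would reduce to
    \<open>f j i\<close>, that is, to \<open>- f i j\<close>.\<close>
  have "\<exists>k. {j, k} \<in> E \<and> f j k \<noteq> 0 \<and> k \<noteq> i" if "{i, j} \<in> E" "f i j \<noteq> 0" for i j
  proof (rule ccontr)
    assume none: "\<nexists>k. {j, k} \<in> E \<and> f j k \<noteq> 0 \<and> k \<noteq> i"
    have "i \<in> {k. {j, k} \<in> E}" using that by (simp add: insert_commute)
    then have "(\<Sum>k\<in>{k. {j, k} \<in> E}. f j k) = f j i + (\<Sum>k\<in>{k. {j, k} \<in> E} - {i}. f j k)"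
      by (rule sum.remove[rotated]) simp
    also have "(\<Sum>k\<in>{k. {j, k} \<in> E} - {i}. f j k) = 0"
      using none by (intro sum.neutral) auto
    finally have "f j i = 0" using conserved[of j] by simp
    then show False using that anti[of i j] by simp
  qed
  then have step: "\<exists>q. ?P q \<and> fst q = snd p \<and> snd q \<noteq> fst p" if "?P p" for p
    using that by (metis fst_conv snd_conv)
  \<comment> \<open>The walk is built from directed edges rather than vertices, so that not
    backtracking is a condition on consecutive terms only.\<close>
  obtain w where w: "\<And>n. ?P (w n)" "\<And>n. fst (w (Suc n)) = snd (w n) \<and> snd (w (Suc n)) \<noteq> fst (w n)"
    using dependent_nat_choice[of "\<lambda>_. ?P" "\<lambda>_ p q. fst q = snd p \<and> snd q \<noteq> fst p"] nz edge step
    by (metis fst_conv snd_conv)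
  have "\<exists>c. graph_cycle E c"
  proof (rule no_backtrack_imp_cycle[OF E])
    show "{fst (w n), fst (w (Suc n))} \<in> E" for n using w(1)[of n] w(2)[of n] by simp
    show "fst (w (Suc (Suc n))) \<noteq> fst (w n)" for n using w(2)[of n] w(2)[of "Suc n"] by metis
  qed
  then show False using acyclic by blast
qed

section \<open>Connected graphs and the scalar Laplacian\<close>

lemma graph_connected_const:
  assumes "graph_connected E" "\<And>i j. {i, j} \<in> E \<Longrightarrow> x i = x j"
  shows "x i = x j"
proof -
  have "(i, j) \<in> {(x, y). {x, y} \<in> E}\<^sup>*" using assms(1) by (simp add: graph_connected_def)
  then show ?thesis by induction (auto dest: assms(2))
qed

text \<open>Summation by parts: add the sum over ordered pairs to its copy with the endpoints
  swapped. Each edge occurs as two ordered pairs.\<close>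

lemma dirichlet_identity:
  fixes E :: "'n::finite set set" and x :: "'n \<Rightarrow> real"
  shows "(\<Sum>i\<in>UNIV. x i * (\<Sum>j\<in>{j. {i, j} \<in> E}. x i - x j)) =
    (\<Sum>(i, j)\<in>{(i, j). {i, j} \<in> E}. (x i - x j)\<^sup>2) / 2"
proof -
  let ?A = "{(i, j). {i, j} \<in> E}"
  have lhs: "(\<Sum>i\<in>UNIV. x i * (\<Sum>j\<in>{j. {i, j} \<in> E}. x i - x j)) = (\<Sum>(i, j)\<in>?A. x i * (x i - x j))"
    by (simp add: sum_distrib_left sum.Sigma Sigma_def) (intro sum.cong, auto)
  have "(\<Sum>(i, j)\<in>?A. x i * (x i - x j)) = (\<Sum>(i, j)\<in>?A. x j * (x j - x i))"
    by (rule sum.reindex_bij_witness[of _ prod.swap prod.swap]) (auto simp: insert_commute)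
  then have "2 * (\<Sum>(i, j)\<in>?A. x i * (x i - x j)) =
      (\<Sum>(i, j)\<in>?A. x i * (x i - x j)) + (\<Sum>(i, j)\<in>?A. x j * (x j - x i))"
    by simp
  also have "\<dots> = (\<Sum>(i, j)\<in>?A. (x i - x j)\<^sup>2)"
    unfolding sum.distrib[symmetric]
    by (intro sum.cong) (auto simp: algebra_simps power2_eq_square)
  finally show ?thesis using lhs by simp
qed

text \<open>The energy is a sum of squares of differences across edges, so all of these vanish when
  it does.\<close>

lemma connected_energy_0_imp_const:
  fixes E :: "'n::finite set set" and x :: "'n \<Rightarrow> real"
  assumes "graph_connected E"
    and "(\<Sum>i\<in>UNIV. x i * (\<Sum>j\<in>{j. {i, j} \<in> E}. x i - x j)) = 0"
  shows "x i = x j"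
proof (rule graph_connected_const[OF assms(1)])
  fix i j assume e: "{i, j} \<in> E"
  have "(\<Sum>(i, j)\<in>{(i, j). {i, j} \<in> E}. (x i - x j)\<^sup>2) = 0"
    using assms(2) by (simp add: dirichlet_identity)
  then have "\<forall>p\<in>{(i, j). {i, j} \<in> E}. (case p of (i, j) \<Rightarrow> (x i - x j)\<^sup>2) = 0"
    by (subst (asm) sum_nonneg_eq_0_iff) auto
  then show "x i = x j" using e by auto
qed

text \<open>The two orientations of an edge contribute opposite terms.\<close>

lemma sum_laplacian_eq_0:
  fixes E :: "'n::finite set set" and x :: "'n \<Rightarrow> real"
  shows "(\<Sum>i\<in>UNIV. \<Sum>j\<in>{j. {i, j} \<in> E}. x i - x j) = 0"
proof -
  let ?A = "{(i, j). {i, j} \<in> E}"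
  have eq: "(\<Sum>i\<in>UNIV. \<Sum>j\<in>{j. {i, j} \<in> E}. x i - x j) = (\<Sum>(i, j)\<in>?A. x i - x j)"
    by (simp add: sum.Sigma Sigma_def) (intro sum.cong, auto)
  have "(\<Sum>(i, j)\<in>?A. x i - x j) = (\<Sum>(i, j)\<in>?A. x j - x i)"
    by (rule sum.reindex_bij_witness[of _ prod.swap prod.swap]) (auto simp: insert_commute)
  also have "\<dots> = - (\<Sum>(i, j)\<in>?A. x i - x j)"
    unfolding sum_negf[symmetric] by (intro sum.cong) auto
  finally show ?thesis using eq by simp
qed

lemma laplacian_solvable:
  fixes E :: "'n::finite set set" and y :: "'n \<Rightarrow> real"
  assumes conn: "graph_connected E" and y: "(\<Sum>i\<in>UNIV. y i) = 0"
  obtains x where "\<And>i. (\<Sum>j\<in>{j. {i, j} \<in> E}. x i - x j) = y i"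
proof -
  let ?lap = "\<lambda>x :: real^'n. \<lambda>i. \<Sum>j\<in>{j. {i, j} \<in> E}. x $ i - x $ j"
  \<comment> \<open>Adding the total sum to every coordinate makes the Laplacian nonsingular.\<close>
  define M where "M x = (\<chi> i. ?lap x i + (\<Sum>j\<in>UNIV. x $ j))" for x :: "real^'n"
  \<comment> \<open>Thus the total of \<open>x\<close> is 0 whenever that of \<open>M x\<close> is,
    and the added term disappears. This serves both for the kernel of \<open>M\<close> and for a
    preimage of \<open>y\<close>.\<close>
  have sum_M: "(\<Sum>i\<in>UNIV. M x $ i) = real CARD('n) * (\<Sum>j\<in>UNIV. x $ j)" for x
    using sum_laplacian_eq_0[of "($) x" E] by (simp add: M_def sum.distrib)
  have lin: "linear M"
    by (auto simp: M_def linear_iff vec_eq_iff sum.distrib sum_subtractf sum_distrib_left algebra_simps)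
  have "inj M"
  proof (rule linear_injective_0[OF lin, THEN iffD2], intro allI impI)
    fix x assume Mx: "M x = 0"
    then have s0: "(\<Sum>j\<in>UNIV. x $ j) = 0" using sum_M[of x] by simp
    then have "?lap x i = 0" for i using Mx by (simp add: M_def vec_eq_iff)
    then have eq: "x $ i = x $ j" for i j
      by (intro connected_energy_0_imp_const[OF conn]) simp
    have "x $ i = 0" for i
    proof -
      have "(\<Sum>j\<in>UNIV. x $ j) = (\<Sum>j\<in>(UNIV :: 'n set). x $ i)" by (intro sum.cong refl eq)
      then show ?thesis using s0 by simp
    qed
    then show "x = 0" by (simp add: vec_eq_iff)
  qed
  then have "surj M" by (rule linear_injective_imp_surjective[OF lin]) simp
  then obtain x where x: "M x = (\<chi> i. y i)" by (metis surjD)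
  then have "(\<Sum>j\<in>UNIV. x $ j) = 0" using sum_M[of x] y by simp
  then have "?lap x i = y i" for i using x by (simp add: M_def vec_eq_iff)
  then show thesis by (rule that)
qed

section \<open>Graphs that are not trees\<close>

lemma cycle_remove_edge_connected:
  fixes E :: "'n::finite set set"
  assumes conn: "graph_connected E" and c: "graph_cycle E c"
  obtains a b where "{a, b} \<in> E" "a \<noteq> b" "graph_connected (E - {{a, b}})"
proof -
  define k where "k = length c"
  have k: "k \<ge> 3" and dist: "distinct c" and ed: "\<And>i. i < k \<Longrightarrow> {c ! i, c ! (Suc i mod k)} \<in> E"
    using c by (auto simp: graph_cycle_def k_def)
  \<comment> \<open>The removed edge is the one that closes the cycle, so the list \<open>c\<close>
    itself is a detour from \<open>a\<close> to \<open>b\<close>.\<close>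
  define a b where "a = c ! 0" and "b = c ! (k - 1)"
  let ?R = "{(x, y). {x, y} \<in> E - {{a, b}}}"
  have nth_eq: "c ! i = c ! j \<longleftrightarrow> i = j" if "i < k" "j < k" for i j
    using dist that by (simp add: k_def nth_eq_iff_index_eq)
  have "a \<noteq> b" using k nth_eq[of 0 "k - 1"] by (simp add: a_def b_def)
  have "{a, b} \<in> E" using ed[of "k - 1"] k by (simp add: a_def b_def insert_commute)
  have "(a, c ! i) \<in> ?R\<^sup>*" if "i < k" for i using that
  proof (induction i)
    case 0
    then show ?case by (simp add: a_def)
  next
    case (Suc i)
    have "{c ! i, c ! Suc i} \<in> E" using ed[of i] Suc.prems by simp
    \<comment> \<open>By distinctness, equality would force \<open>k = 2\<close> or
      \<open>i = k - 1\<close>, against \<open>k >= 3\<close> and \<open>Suc i < k\<close>.\<close>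
    moreover have "{c ! i, c ! Suc i} \<noteq> {a, b}"
    proof
      assume "{c ! i, c ! Suc i} = {a, b}"
      then have "c ! i = a \<and> c ! Suc i = b \<or> c ! i = b" by (simp add: doubleton_eq_iff) blast
      moreover have "c ! i = a \<longleftrightarrow> i = 0" "c ! i = b \<longleftrightarrow> i = k - 1" "c ! Suc i = b \<longleftrightarrow> Suc i = k - 1"
        unfolding a_def b_def by (rule nth_eq; use k Suc.prems in linarith)+
      ultimately show False using k Suc.prems by linarith
    qed
    ultimately have "(c ! i, c ! Suc i) \<in> ?R" by simp
    moreover have "(a, c ! i) \<in> ?R\<^sup>*" using Suc by simp
    ultimately show ?case by (rule rtrancl_into_rtrancl[rotated])
  qed
  then have ab: "(a, b) \<in> ?R\<^sup>*" using k by (simp add: b_def)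
  have "sym ?R" by (auto simp: sym_def insert_commute)
  then have ba: "(b, a) \<in> ?R\<^sup>*" using ab by (metis sym_rtrancl symD)
  \<comment> \<open>Every edge either survives or is \<open>{a, b}\<close>, which the detour
    replaces in both directions.\<close>
  have "{(x, y). {x, y} \<in> E} \<subseteq> ?R\<^sup>*"
    using ab ba by (auto simp: doubleton_eq_iff)
  then have "{(x, y). {x, y} \<in> E}\<^sup>* \<subseteq> ?R\<^sup>*" by (metis rtrancl_mono rtrancl_idemp)
  then have "graph_connected (E - {{a, b}})" using conn by (auto simp: graph_connected_def)
  then show thesis using that \<open>a \<noteq> b\<close> \<open>{a, b} \<in> E\<close> by blast
qed

text \<open>The scalar core of the converse: \<open>g\<close> stands for the inverse weights, and
  \<open>x\<close> is a nonconstant kernel element.\<close>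

lemma not_tree_imp_nonconst_harmonic:
  fixes E :: "'n::finite set set"
  assumes E: "simple_graph E" and not_tree: "\<not> is_tree E"
  obtains g :: "'n set \<Rightarrow> real" and x i j where "\<And>e. g e \<noteq> 0"
    "\<And>i. (\<Sum>j\<in>{j. {i, j} \<in> E}. g {i, j} * (x i - x j)) = 0" "x i \<noteq> x j"
proof (cases "graph_connected E")
  case False
  define R where "R = {(x, y). {x, y} \<in> E}"
  obtain u v where uv: "(u, v) \<notin> R\<^sup>*" using False by (auto simp: graph_connected_def R_def)
  define x :: "'n \<Rightarrow> real" where "x i = (if (u, i) \<in> R\<^sup>* then 1 else 0)" for i
  have "x i = x j" if "{i, j} \<in> E" for i j
  proof -
    have "(i, j) \<in> R" "(j, i) \<in> R" using that by (auto simp: insert_commute R_def)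
    then show ?thesis by (auto simp: x_def intro: rtrancl_into_rtrancl)
  qed
  then have "(\<Sum>j\<in>{j. {i, j} \<in> E}. 1 * (x i - x j)) = 0" for i
    by (intro sum.neutral) auto
  moreover have "x u \<noteq> x v" using uv by (simp add: x_def)
  ultimately show thesis using that[of "\<lambda>_. 1" x u v] by simp
next
  case True
  then obtain c where "graph_cycle E c" using not_tree by (auto simp: is_tree_def)
  then obtain a b where ab: "{a, b} \<in> E" "a \<noteq> b" "graph_connected (E - {{a, b}})"
    using cycle_remove_edge_connected[OF True] by metis
  let ?E = "E - {{a, b}}"
  define y :: "'n \<Rightarrow> real" where "y i = (if i = a then 1 else 0) - (if i = b then 1 else 0)" for i
  have "(\<Sum>i\<in>UNIV. y i) = 0" by (simp add: y_def sum_subtractf)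
  then obtain x where x: "\<And>i. (\<Sum>j\<in>{j. {i, j} \<in> ?E}. x i - x j) = y i"
    using laplacian_solvable[OF ab(3)] by metis
  \<comment> \<open>This pairing is the energy of \<open>x\<close>. If \<open>x a = x b\<close>, it
    would vanish and \<open>x\<close> would be constant, contradicting
    \<open>y a = 1\<close>.\<close>
  have "(\<Sum>i\<in>UNIV. x i * y i) = x a - x b"
    by (simp add: y_def right_diff_distrib sum_subtractf if_distrib[of "\<lambda>z. _ * z"] cong: if_cong)
  then have energy: "(\<Sum>i\<in>UNIV. x i * (\<Sum>j\<in>{j. {i, j} \<in> ?E}. x i - x j)) = x a - x b"
    using x by simp
  have ne: "x a \<noteq> x b"
  proof
    assume "x a = x b"
    then have "x i = x j" for i j
      using energy by (intro connected_energy_0_imp_const[OF ab(3)]) simp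
    then have "(\<Sum>j\<in>{j. {a, j} \<in> ?E}. x a - x j) = 0" by (intro sum.neutral ballI) (metis diff_self)
    then show False using x[of a] ab(2) by (simp add: y_def)
  qed
  \<comment> \<open>The negative conductance on the edge ab carries the unit current from a to b back.\<close>
  define g where "g e = (if e = {a, b} then - 1 / (x a - x b) else 1)" for e
  have "(\<Sum>j\<in>{j. {i, j} \<in> E}. g {i, j} * (x i - x j)) = 0" for i
  proof -
    have "(\<Sum>j\<in>{j. {i, j} \<in> E}. g {i, j} * (x i - x j)) =
        (\<Sum>j\<in>{j. {i, j} \<in> ?E}. g {i, j} * (x i - x j)) + (\<Sum>j\<in>{j. {i, j} = {a, b}}. g {i, j} * (x i - x j))"
      using ab(1) by (subst sum.union_disjoint[symmetric]) (auto intro!: sum.cong)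
    also have "(\<Sum>j\<in>{j. {i, j} \<in> ?E}. g {i, j} * (x i - x j)) = y i"
      unfolding x[symmetric] by (intro sum.cong) (auto simp: g_def)
    also have "(\<Sum>j\<in>{j. {i, j} = {a, b}}. g {i, j} * (x i - x j)) = - y i"
    proof -
      have "{j. {i, j} = {a, b}} = (if i = a then {b} else if i = b then {a} else {})"
        using ab(2) by (auto simp: doubleton_eq_iff)
      then show ?thesis using ab(2) ne
        by (auto simp: g_def y_def insert_commute divide_simps)
    qed
    finally show ?thesis by simp
  qed
  moreover have "g e \<noteq> 0" for e using ne by (simp add: g_def)
  ultimately show thesis using that ne by blast
qed

theorem theorem2p4:
  fixes E :: "'n::finite set set"
  assumes "simple_graph E"
  shows "(\<forall>W :: 'n set \<Rightarrow> real^'s::finite^'s. (\<forall>e\<in>E. invertible (W e)) \<longrightarrow>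
            rank (weighted_laplacian E W) = (CARD('n) - 1) * CARD('s))
         \<longleftrightarrow> is_tree E"
proof
  assume tree: "is_tree E"
  show "\<forall>W :: 'n set \<Rightarrow> real^'s::finite^'s. (\<forall>e\<in>E. invertible (W e)) \<longrightarrow>
            rank (weighted_laplacian E W) = (CARD('n) - 1) * CARD('s)"
    unfolding rank_weighted_laplacian_iff[OF assms]
  proof (intro allI impI)
    fix W :: "'n set \<Rightarrow> real^'s^'s" and x :: "'n \<Rightarrow> real^'s" and i j
    assume W: "\<forall>e\<in>E. invertible (W e)"
      and x: "\<forall>i. (\<Sum>j\<in>{j. {i, j} \<in> E}. matrix_inv (W {i, j}) *v (x i - x j)) = 0"
    show "x i = x j"
    proof (rule graph_connected_const)
      show "graph_connected E" using tree by (simp add: is_tree_def)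
      fix a b assume ab: "{a, b} \<in> E"
      have "matrix_inv (W {a, b}) *v (x a - x b) = 0"
      \<comment> \<open>This flow is antisymmetric because the weight depends only on the unordered
        pair.\<close>
      proof (rule acyclic_flow_eq_0[OF assms, of "\<lambda>a b. matrix_inv (W {a, b}) *v (x a - x b)"])
        show "matrix_inv (W {b, a}) *v (x b - x a) = - (matrix_inv (W {a, b}) *v (x a - x b))" for a b
          by (simp add: matrix_vector_mult_diff_distrib insert_commute)
      qed (use tree x ab in \<open>auto simp: is_tree_def\<close>)
      then show "x a = x b" using W ab by (simp add: matrix_inv_mult_eq_0_iff)
    qed
  qed
next
  assume rk: "\<forall>W :: 'n set \<Rightarrow> real^'s::finite^'s. (\<forall>e\<in>E. invertible (W e)) \<longrightarrow>
            rank (weighted_laplacian E W) = (CARD('n) - 1) * CARD('s)"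
  show "is_tree E"
  proof (rule ccontr)
    assume "\<not> is_tree E"
    then obtain g :: "'n set \<Rightarrow> real" and x i j where g: "\<And>e. g e \<noteq> 0"
      and x: "\<And>i. (\<Sum>j\<in>{j. {i, j} \<in> E}. g {i, j} * (x i - x j)) = 0" and ne: "x i \<noteq> x j"
      by (rule not_tree_imp_nonconst_harmonic[OF assms]) blast
    \<comment> \<open>The reciprocal appears because the Laplacian inverts the weights. The scalar
      solution is lifted along the all-ones vector, which is nonzero and so keeps it
      nonconstant.\<close>
    let ?W = "\<lambda>e. mat (1 / g e) :: real^'s^'s"
    let ?x = "\<lambda>i. x i *\<^sub>R (1 :: real^'s)"
    have "rank (weighted_laplacian E ?W) = (CARD('n) - 1) * CARD('s)"
      using rk g by (simp add: matrix_inv_mat)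
    moreover have "(\<Sum>j\<in>{j. {i, j} \<in> E}. matrix_inv (?W {i, j}) *v (?x i - ?x j)) = 0" for i
    proof -
      have "(\<Sum>j\<in>{j. {i, j} \<in> E}. matrix_inv (?W {i, j}) *v (?x i - ?x j)) =
          (\<Sum>j\<in>{j. {i, j} \<in> E}. (g {i, j} * (x i - x j)) *\<^sub>R 1)"
        using g by (simp add: matrix_inv_mat scaleR_diff_left[symmetric])
      then show ?thesis using x[of i] by (simp add: scaleR_sum_left[symmetric])
    qed
    ultimately have "?x i = ?x j"
      using rank_weighted_laplacian_iff[OF assms, of ?W, THEN iffD1, THEN spec[of _ ?x]] by blast
    then show False using ne by (simp add: vec_eq_iff)
  qed
qed

end
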